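(* Let $X$ and $Y$ be Polish spaces and $c:X\times Y\to\mathbb{R}$ a cost function, with the abstract Lax-Oleinik operators $T^-$, $T^+$ (all infima and suprema defining them being attained). (A) For $\psi:Y\to\mathbb{R}$ the following statements are equivalent: (1) $T^-\circ T^+\psi=\psi$; (2) $\partial^c\psi(y)\neq\varnothing$ for all $y\in Y$; (3) there exists $\phi:X\to\mathbb{R}$ such that $\psi=T^-\phi$; (4) $\psi$ is $c$-concave. (B) For $\phi:X\to\mathbb{R}$ the following statements are equivalent: (1) $T^+\circ T^-\phi=\phi$; (2) $\partial_c\phi(x)\neq\varnothing$ for all $x\in X$; (3) there exists $\psi:Y\to\mathbb{R}$ such that $\phi=T^+\psi$; (4) $\phi$ is $c$-convex.
   Context: For $\phi:X\to\mathbb{R}$ and $\psi:Y\to\mathbb{R}$ the abstract Lax-Oleinik operators are $$T^-\phi(y):=\inf_{x\in X}\{\phi(x)+c(x,y)\},\qquad T^+\psi(x):=\sup_{y\in Y}\{\psi(y)-c(x,y)\},\qquad x\in X,\ y\in Y.$$ Standing assumption: for all functions to which $T^-$ or $T^+$ is applied (including in the compositions $T^-\circ T^+$ and $T^+\circ T^-$), the infimum, resp. supremum, in the definition is attained at every point (in particular the values are finite). A function $\psi:Y\to[-\infty,+\infty)$ is $c$-concave if it is the infimum of a family of functions of the form $c(x,\cdot)+\alpha(x)$ (with $x\in X$, $\alpha(x)$ a constant). A function $\phi:X\to(-\infty,+\infty]$ is $c$-convex if it is the supremum of a family of functions of the form $\beta(y)-c(\cdot,y)$. $c$-superdifferential and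 $c$-subdifferential: $$\partial^c\psi(y):=\{x\in X:\ \psi(\cdot)-c(x,\cdot)\ \text{attains its maximum at}\ y\},$$ $$\partial_c\phi(x):=\{y\in Y:\ \phi(\cdot)+c(\cdot,y)\ \text{attains its minimum at}\ x\}.$$ *)

theory Defs
  imports "HOL-Analysis.Analysis"
begin

text \<open>
  \<open>Inf\<close> and \<open>Sup\<close> on \<open>real\<close> are unspecified on sets that are empty or unbounded on the relevant
  side; \<open>Tminus\<close> and \<open>Tplus\<close> are only meaningful for functions satisfying
  \<open>Tminus_attained\<close> and \<open>Tplus_attained\<close>, respectively.
\<close>

definition Tminus :: "('a \<Rightarrow> 'b \<Rightarrow> real) \<Rightarrow> ('a \<Rightarrow> real) \<Rightarrow> 'b \<Rightarrow> real" where
  "Tminus c \<phi> y = (INF x. \<phi> x + c x y)"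

definition Tplus :: "('a \<Rightarrow> 'b \<Rightarrow> real) \<Rightarrow> ('b \<Rightarrow> real) \<Rightarrow> 'a \<Rightarrow> real" where
  "Tplus c \<psi> x = (SUP y. \<psi> y - c x y)"

definition Tminus_attained :: "('a \<Rightarrow> 'b \<Rightarrow> real) \<Rightarrow> ('a \<Rightarrow> real) \<Rightarrow> bool" where
  "Tminus_attained c \<phi> \<longleftrightarrow> (\<forall>y. \<exists>x. \<forall>x'. \<phi> x + c x y \<le> \<phi> x' + c x' y)"

definition Tplus_attained :: "('a \<Rightarrow> 'b \<Rightarrow> real) \<Rightarrow> ('b \<Rightarrow> real) \<Rightarrow> bool" where
  "Tplus_attained c \<psi> \<longleftrightarrow> (\<forall>x. \<exists>y. \<forall>y'. \<psi> y' - c x y' \<le> \<psi> y - c x y)"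

text \<open>
  A \<open>c\<close>-concave function takes values in \<open>[-\<infinity>, \<infinity>)\<close> and a \<open>c\<close>-convex one in \<open>(-\<infinity>, \<infinity>]\<close>. Requiring
  \<open>F \<noteq> {}\<close> excludes exactly the constant \<open>\<infinity>\<close> (resp. \<open>-\<infinity>\<close>), which the empty family would give.
\<close>

definition c_concave :: "('a \<Rightarrow> 'b \<Rightarrow> real) \<Rightarrow> ('b \<Rightarrow> ereal) \<Rightarrow> bool" where
  "c_concave c \<psi> \<longleftrightarrow>
    (\<exists>F :: ('b \<Rightarrow> real) set. F \<noteq> {} \<and>
      (\<forall>f\<in>F. \<exists>x \<alpha>. f = (\<lambda>y. c x y + \<alpha>)) \<and>
      (\<forall>y. \<psi> y = (INF f\<in>F. ereal (f y))))"

definition c_convex :: "('a \<Rightarrow> 'b \<Rightarrow> real) \<Rightarrow> ('a \<Rightarrow> ereal) \<Rightarrow> bool" where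
  "c_convex c \<phi> \<longleftrightarrow>
    (\<exists>F :: ('a \<Rightarrow> real) set. F \<noteq> {} \<and>
      (\<forall>f\<in>F. \<exists>y \<beta>. f = (\<lambda>x. \<beta> - c x y)) \<and>
      (\<forall>x. \<phi> x = (SUP f\<in>F. ereal (f x))))"

definition c_superdifferential :: "('a \<Rightarrow> 'b \<Rightarrow> real) \<Rightarrow> ('b \<Rightarrow> real) \<Rightarrow> 'b \<Rightarrow> 'a set" where
  "c_superdifferential c \<psi> y = {x. \<forall>z. \<psi> z - c x z \<le> \<psi> y - c x y}"

definition c_subdifferential :: "('a \<Rightarrow> 'b \<Rightarrow> real) \<Rightarrow> ('a \<Rightarrow> real) \<Rightarrow> 'a \<Rightarrow> 'b set" where
  "c_subdifferential c \<phi> x = {y. \<forall>z. \<phi> x + c x y \<le> \<phi> z + c z y}"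

end

theory Submission
  imports Defs
begin

text \<open>
  Since \<open>T\<^sup>- \<circ> T\<^sup>+ \<psi> \<ge> \<psi>\<close> always holds, the statements of (A) all express the converse inequality:
  an element of \<open>\<partial>\<^sup>c\<psi>(y)\<close> is a point \<open>x\<close> with \<open>T\<^sup>+ \<psi>(x) + c(x, y) \<le> \<psi>(y)\<close>, and any function
  \<open>c(x, \<cdot>) + \<alpha>\<close> above \<open>\<psi>\<close> has \<open>\<alpha> \<ge> T\<^sup>+ \<psi>(x)\<close>, hence lies above \<open>T\<^sup>- \<circ> T\<^sup>+ \<psi>\<close>. Changing the sign of
  the functions and exchanging the two spaces interchanges \<open>T\<^sup>-\<close> and \<open>T\<^sup>+\<close>, which reduces (B) to (A).
\<close>

text \<open>Attainment makes the family bounded below, so the real \<open>INF\<close> in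
  \<open>Tminus\<close> is the true infimum and not an unspecified value.\<close>

lemma Tminus_lower:
  assumes "Tminus_attained c \<phi>"
  shows "Tminus c \<phi> y \<le> \<phi> x + c x y"
proof -
  have "bdd_below (range (\<lambda>x. \<phi> x + c x y))"
    using assms unfolding Tminus_attained_def bdd_below_def by blast
  then show ?thesis
    unfolding Tminus_def by (rule cINF_lower) simp
qed

lemma Tminus_attainedE:
  assumes "Tminus_attained c \<phi>"
  obtains x where "Tminus c \<phi> y = \<phi> x + c x y"
proof -
  obtain x where x: "\<And>x'. \<phi> x + c x y \<le> \<phi> x' + c x' y"
    using assms unfolding Tminus_attained_def by blast
  have "\<phi> x + c x y \<le> Tminus c \<phi> y"
    unfolding Tminus_def by (rule cINF_greatest) (use x in auto)
  then show ?thesis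
    by (intro that order_antisym Tminus_lower[OF assms])
qed

text \<open>Cancels the double signs that appear when a function is reflected twice on the way
  between (A) and (B).\<close>

lemma uminus_fun_involution:
  fixes f :: "'a \<Rightarrow> 'b::group_add"
  shows "- (- f) = f"
  by (rule ext) simp

text \<open>On \<open>real\<close>, \<open>Inf\<close> is defined as the negated \<open>Sup\<close>
  of the negated set, so the reflection is an identity of terms, whether or not the extrema
  exist.\<close>

lemma Tplus_conv_Tminus: "Tplus c \<psi> = - Tminus (\<lambda>y x. c x y) (- \<psi>)"
  by (rule ext) (simp add: Tplus_def Tminus_def Inf_real_def image_image)

lemma Tminus_conv_Tplus: "Tminus c \<phi> = - Tplus (\<lambda>y x. c x y) (- \<phi>)"
  by (simp add: Tplus_conv_Tminus uminus_fun_involution)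

lemma Tplus_attained_conv:
  "Tplus_attained c \<psi> \<longleftrightarrow> Tminus_attained (\<lambda>y x. c x y) (- \<psi>)"
  by (simp add: Tplus_attained_def Tminus_attained_def algebra_simps)

lemma Tminus_attained_conv:
  "Tminus_attained c \<phi> \<longleftrightarrow> Tplus_attained (\<lambda>y x. c x y) (- \<phi>)"
  by (simp add: Tplus_attained_conv uminus_fun_involution)

lemma Tplus_upper:
  assumes "Tplus_attained c \<psi>"
  shows "\<psi> y - c x y \<le> Tplus c \<psi> x"
  using Tminus_lower[of "\<lambda>y x. c x y" "- \<psi>" x y] assms
  by (simp add: Tplus_conv_Tminus Tplus_attained_conv)

lemma Tplus_least:
  assumes "\<And>y. \<psi> y - c x y \<le> a"
  shows "Tplus c \<psi> x \<le> a"
  unfolding Tplus_def by (rule cSUP_least) (use assms in auto)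

lemma c_subdifferential_conv:
  "c_subdifferential c \<phi> x = c_superdifferential (\<lambda>y x. c x y) (- \<phi>) x"
  by (auto simp: c_subdifferential_def c_superdifferential_def algebra_simps)

text \<open>Negating every member of a family for \<phi> turns \<beta> - c(x, y) into c(x, y) +
  (-\<beta>) and the supremum into an infimum.\<close>

lemma c_convex_imp_c_concave:
  assumes "c_convex c \<phi>"
  shows "c_concave (\<lambda>y x. c x y) (\<lambda>x. - \<phi> x)"
proof -
  obtain F where F: "F \<noteq> {}" "\<forall>f\<in>F. \<exists>y \<beta>. f = (\<lambda>x. \<beta> - c x y)"
    "\<forall>x. \<phi> x = (SUP f\<in>F. ereal (f x))"
    using assms unfolding c_convex_def by blast
  have "\<forall>f\<in>uminus ` F. \<exists>y \<alpha>. f = (\<lambda>x. c x y + \<alpha>)"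
  proof
    fix f assume "f \<in> uminus ` F"
    then obtain y \<beta> where "f = - (\<lambda>x. \<beta> - c x y)"
      using F(2) by fast
    then have "f = (\<lambda>x. c x y + - \<beta>)"
      by auto
    then show "\<exists>y \<alpha>. f = (\<lambda>x. c x y + \<alpha>)"
      by blast
  qed
  moreover have "- \<phi> x = (INF f\<in>uminus ` F. ereal (f x))" for x
    using F(3) by (simp add: image_image ereal_INF_uminus_eq[symmetric] flip: uminus_ereal.simps(1))
  ultimately show ?thesis
    using F(1) unfolding c_concave_def by (intro exI[of _ "uminus ` F"]) auto
qed

lemma c_concave_imp_c_convex:
  assumes "c_concave c \<psi>"
  shows "c_convex (\<lambda>y x. c x y) (\<lambda>y. - \<psi> y)"
proof -
  obtain F where F: "F \<noteq> {}" "\<forall>f\<in>F. \<exists>x \<alpha>. f = (\<lambda>y. c x y + \<alpha>)"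
    "\<forall>y. \<psi> y = (INF f\<in>F. ereal (f y))"
    using assms unfolding c_concave_def by blast
  have "\<forall>f\<in>uminus ` F. \<exists>x \<beta>. f = (\<lambda>y. \<beta> - c x y)"
  proof
    fix f assume "f \<in> uminus ` F"
    then obtain x \<alpha> where "f = - (\<lambda>y. c x y + \<alpha>)"
      using F(2) by fast
    then have "f = (\<lambda>y. - \<alpha> - c x y)"
      by auto
    then show "\<exists>x \<beta>. f = (\<lambda>y. \<beta> - c x y)"
      by blast
  qed
  moreover have "- \<psi> y = (SUP f\<in>uminus ` F. ereal (f y))" for y
    using F(3) by (simp add: image_image ereal_SUP_uminus_eq[symmetric] flip: uminus_ereal.simps(1))
  ultimately show ?thesis
    using F(1) unfolding c_convex_def by (intro exI[of _ "uminus ` F"]) auto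
qed

text \<open>Reflecting twice restores both the cost and the function, so the two one-way
  implications are converse to each other.\<close>

lemma c_convex_conv:
  fixes \<phi> :: "'a \<Rightarrow> real"
  shows "c_convex c (\<lambda>x. ereal (\<phi> x)) \<longleftrightarrow> c_concave (\<lambda>y x. c x y) (\<lambda>x. ereal ((- \<phi>) x))"
  using c_convex_imp_c_concave[of c "\<lambda>x. ereal (\<phi> x)"]
    c_concave_imp_c_convex[of "\<lambda>y x. c x y" "\<lambda>x. ereal ((- \<phi>) x)"]
  by auto

text \<open>At a minimiser x for the outer operator, the claim is just \<psi>(y) - c(x, y) \<le>
  \<open>Tplus c \<psi> x\<close>.\<close>

lemma Tminus_Tplus_ge:
  assumes "Tplus_attained c \<psi>" and "Tminus_attained c (Tplus c \<psi>)"
  shows "\<psi> y \<le> Tminus c (Tplus c \<psi>) y"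
proof -
  obtain x where "Tminus c (Tplus c \<psi>) y = Tplus c \<psi> x + c x y"
    by (rule Tminus_attainedE[OF assms(2)])
  then show ?thesis
    using Tplus_upper[OF assms(1), of y x] by simp
qed

lemma Tminus_Tplus_eq_iff:
  assumes "Tplus_attained c \<psi>" and "Tminus_attained c (Tplus c \<psi>)"
  shows "Tminus c (Tplus c \<psi>) = \<psi> \<longleftrightarrow> (\<forall>y. c_superdifferential c \<psi> y \<noteq> {})"
proof
  assume eq: "Tminus c (Tplus c \<psi>) = \<psi>"
  show "\<forall>y. c_superdifferential c \<psi> y \<noteq> {}"
  proof
    fix y
    \<comment> \<open>The witness is the minimiser in \<open>Tminus c (Tplus c \<psi>) y\<close>:
      there \<psi>(y) - c(x, y) equals the supremum \<open>Tplus c \<psi> x\<close>.\<close>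
    obtain x where "\<psi> y = Tplus c \<psi> x + c x y"
      using Tminus_attainedE[OF assms(2), of y] eq by metis
    then have "x \<in> c_superdifferential c \<psi> y"
      using Tplus_upper[OF assms(1), of _ x] by (simp add: c_superdifferential_def)
    then show "c_superdifferential c \<psi> y \<noteq> {}"
      by blast
  qed
next
  assume nonempty: "\<forall>y. c_superdifferential c \<psi> y \<noteq> {}"
  have "Tminus c (Tplus c \<psi>) y \<le> \<psi> y" for y
  proof -
    obtain x where "\<And>z. \<psi> z - c x z \<le> \<psi> y - c x y"
      using nonempty unfolding c_superdifferential_def by blast
    then have "Tplus c \<psi> x \<le> \<psi> y - c x y"
      by (rule Tplus_least)
    then show ?thesis
      using Tminus_lower[OF assms(2), of y x] by simp
  qed
  then show "Tminus c (Tplus c \<psi>) = \<psi>"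
    using Tminus_Tplus_ge[OF assms] by (simp add: fun_eq_iff order_antisym)
qed

text \<open>The constants are \<alpha>(x) = \<phi>(x). A minimiser at y gives a member of the family
  with the value \<open>Tminus c \<phi> y\<close>, so the infimum in \<open>ereal\<close> agrees
  with the real one.\<close>

lemma c_concave_Tminus:
  assumes "Tminus_attained c \<phi>"
  shows "c_concave c (\<lambda>y. ereal (Tminus c \<phi> y))"
proof -
  let ?F = "range (\<lambda>x y. c x y + \<phi> x)"
  have "ereal (Tminus c \<phi> y) = (INF f\<in>?F. ereal (f y))" for y
  proof (rule antisym)
    show "ereal (Tminus c \<phi> y) \<le> (INF f\<in>?F. ereal (f y))"
      using Tminus_lower[OF assms] by (auto intro!: INF_greatest simp: add.commute)
    obtain x where "Tminus c \<phi> y = \<phi> x + c x y"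
      by (rule Tminus_attainedE[OF assms])
    then show "(INF f\<in>?F. ereal (f y)) \<le> ereal (Tminus c \<phi> y)"
      by (auto intro!: INF_lower2[of "\<lambda>y. c x y + \<phi> x"])
  qed
  then show ?thesis
    unfolding c_concave_def by (intro exI[of _ ?F]) auto
qed

lemma c_concave_imp_Tminus_Tplus_eq:
  assumes "Tplus_attained c \<psi>" and "Tminus_attained c (Tplus c \<psi>)"
    and "c_concave c (\<lambda>y. ereal (\<psi> y))"
  shows "Tminus c (Tplus c \<psi>) = \<psi>"
proof -
  obtain F where F: "\<forall>f\<in>F. \<exists>x \<alpha>. f = (\<lambda>y. c x y + \<alpha>)"
    "\<And>y. ereal (\<psi> y) = (INF f\<in>F. ereal (f y))"
    using assms(3) unfolding c_concave_def by blast
  have "Tminus c (Tplus c \<psi>) y \<le> f y" if f: "f \<in> F" for f y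
  proof -
    obtain x \<alpha> where f_eq: "f = (\<lambda>y. c x y + \<alpha>)"
      using F(1) f by blast
    \<comment> \<open>Being the infimum of \<open>F\<close>, \<psi> lies below each member; hence
      \<alpha> bounds all \<psi>(z) - c(x, z), and so their supremum.\<close>
    have "\<psi> z \<le> f z" for z
      using INF_lower[OF f, of "\<lambda>f. ereal (f z)"] by (simp flip: F(2))
    then have "\<psi> z - c x z \<le> \<alpha>" for z
      unfolding f_eq by (simp add: algebra_simps)
    then have "Tplus c \<psi> x \<le> \<alpha>"
      by (rule Tplus_least)
    then show ?thesis
      using Tminus_lower[OF assms(2), of y x] f_eq by simp
  qed
  then have "ereal (Tminus c (Tplus c \<psi>) y) \<le> ereal (\<psi> y)" for y
    unfolding F(2) by (intro INF_greatest) simp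
  then show ?thesis
    using Tminus_Tplus_ge[OF assms(1,2)] by (simp add: fun_eq_iff order_antisym)
qed

text \<open>Besides (1) \<longleftrightarrow> (2), the cycle is (1) to (3) with \<phi> =
  \<open>Tplus c \<psi>\<close>, then (3) to (4) to (1). Statement (3) asks for attainment because
  the standing assumption covers \<phi> too.\<close>

lemma c_concave_equivalences:
  assumes "Tplus_attained c \<psi>" and "Tminus_attained c (Tplus c \<psi>)"
  shows "(Tminus c (Tplus c \<psi>) = \<psi> \<longleftrightarrow> (\<forall>y. c_superdifferential c \<psi> y \<noteq> {})) \<and>
    ((\<forall>y. c_superdifferential c \<psi> y \<noteq> {}) \<longleftrightarrow>
      (\<exists>\<phi>. Tminus_attained c \<phi> \<and> \<psi> = Tminus c \<phi>)) \<and>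
    ((\<exists>\<phi>. Tminus_attained c \<phi> \<and> \<psi> = Tminus c \<phi>) \<longleftrightarrow> c_concave c (\<lambda>y. ereal (\<psi> y)))"
  using Tminus_Tplus_eq_iff[OF assms] c_concave_Tminus[of c]
    c_concave_imp_Tminus_Tplus_eq[OF assms] assms(2) by metis

lemma c_convex_equivalences:
  assumes "Tminus_attained c \<phi>" and "Tplus_attained c (Tminus c \<phi>)"
  shows "(Tplus c (Tminus c \<phi>) = \<phi> \<longleftrightarrow> (\<forall>x. c_subdifferential c \<phi> x \<noteq> {})) \<and>
    ((\<forall>x. c_subdifferential c \<phi> x \<noteq> {}) \<longleftrightarrow>
      (\<exists>\<psi>. Tplus_attained c \<psi> \<and> \<phi> = Tplus c \<psi>)) \<and>
    ((\<exists>\<psi>. Tplus_attained c \<psi> \<and> \<phi> = Tplus c \<psi>) \<longleftrightarrow> c_convex c (\<lambda>x. ereal (\<phi> x)))"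
proof -
  \<comment> \<open>Each statement about \<phi> and \<open>c\<close> is translated into the
    corresponding statement of (A) about -\<phi> and the exchanged cost.\<close>
  let ?c = "\<lambda>y x. c x y"
  have "Tplus c (Tminus c \<phi>) = \<phi> \<longleftrightarrow> Tminus ?c (Tplus ?c (- \<phi>)) = - \<phi>"
    by (simp add: Tplus_conv_Tminus[of c] Tminus_conv_Tplus[of c] uminus_fun_involution)
      (metis uminus_fun_involution)
  \<comment> \<open>Witnesses on the two sides correspond under \<psi> \<mapsto> -\<psi>.\<close>
  moreover have "(\<exists>\<psi>. Tplus_attained c \<psi> \<and> \<phi> = Tplus c \<psi>) \<longleftrightarrow>
      (\<exists>\<psi>. Tminus_attained ?c \<psi> \<and> - \<phi> = Tminus ?c \<psi>)"
    unfolding Tplus_attained_conv Tplus_conv_Tminus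
    by (metis uminus_fun_involution)
  moreover have "Tplus_attained ?c (- \<phi>)" "Tminus_attained ?c (Tplus ?c (- \<phi>))"
    using assms by (simp_all add: Tminus_attained_conv[of c] Tplus_attained_conv[of c]
      Tminus_conv_Tplus[of c] uminus_fun_involution)
  ultimately show ?thesis
    using c_concave_equivalences[of ?c "- \<phi>"]
    by (simp only: c_subdifferential_conv c_convex_conv)
qed

theorem theorem3p6:
  fixes c :: "'a::polish_space \<Rightarrow> 'b::polish_space \<Rightarrow> real"
  shows
    "(\<forall>\<psi> :: 'b \<Rightarrow> real.
        Tplus_attained c \<psi> \<and> Tminus_attained c (Tplus c \<psi>) \<longrightarrow>
          ((Tminus c \<circ> Tplus c) \<psi> = \<psi> \<longleftrightarrow> (\<forall>y. c_superdifferential c \<psi> y \<noteq> {})) \<and>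
          ((\<forall>y. c_superdifferential c \<psi> y \<noteq> {}) \<longleftrightarrow>
            (\<exists>\<phi> :: 'a \<Rightarrow> real. Tminus_attained c \<phi> \<and> \<psi> = Tminus c \<phi>)) \<and>
          ((\<exists>\<phi> :: 'a \<Rightarrow> real. Tminus_attained c \<phi> \<and> \<psi> = Tminus c \<phi>) \<longleftrightarrow>
            c_concave c (\<lambda>y. ereal (\<psi> y)))) \<and>
     (\<forall>\<phi> :: 'a \<Rightarrow> real.
        Tminus_attained c \<phi> \<and> Tplus_attained c (Tminus c \<phi>) \<longrightarrow>
          ((Tplus c \<circ> Tminus c) \<phi> = \<phi> \<longleftrightarrow> (\<forall>x. c_subdifferential c \<phi> x \<noteq> {})) \<and>
          ((\<forall>x. c_subdifferential c \<phi> x \<noteq> {}) \<longleftrightarrow>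
            (\<exists>\<psi> :: 'b \<Rightarrow> real. Tplus_attained c \<psi> \<and> \<phi> = Tplus c \<psi>)) \<and>
          ((\<exists>\<psi> :: 'b \<Rightarrow> real. Tplus_attained c \<psi> \<and> \<phi> = Tplus c \<psi>) \<longleftrightarrow>
            c_convex c (\<lambda>x. ereal (\<phi> x))))"
  using c_concave_equivalences[of c] c_convex_equivalences[of c] by (simp only: comp_apply) blast

end
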